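(* Let $n\ge 2$. For any convex body $K\subset\mathbb{R}^n$ one has $$\sup_{u,v\in S^{n-1},\,u\neq\pm v}\Delta w_K(u,v)\le\hat M_K\qquad\text{and}\qquad w_K'(u)\le p_K(u)\ \text{ for every } u\in S^{n-1}.$$
   Context: A convex body in $\mathbb{R}^n$ is a compact convex set with nonempty interior. A supporting hyperplane of $K$ is an affine hyperplane that intersects $K$ but not its interior. For $u\in S^{n-1}$ (the Euclidean unit sphere of $\mathbb{R}^n$), let $H_1(u),H_2(u)$ be the two supporting hyperplanes of $K$ orthogonal to $u$, let $w_K(u)$ be the distance between them, and set $$s_K(u):=\max\{|A'B'|:A'\in K\cap H_1(u),\ B'\in K\cap H_2(u)\},\qquad p_K(u):=\sqrt{s_K(u)^2-w_K(u)^2}.$$ $\hat M_K:=\max_{u\in S^{n-1}}p_K(u)$ (attained since $p_K$ is upper semicontinuous). $\rho(u,v):=\arccos|\langle u,v\rangle|$; for $u\ne\pm v$, $\Delta w_K(u,v):=|w_K(u)-w_K(v)|/\rho(u,v)$; and $w_K'(u):=\limsup_{u',u''\to u}\Delta w_K(u',u'')$, the limsup being over $u',u''\in S^{n-1}$, $u'\ne\pm u''$, both tending to $u$. *)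

theory Defs
  imports "HOL-Analysis.Analysis"
begin

definition convex_body :: "'a::euclidean_space set \<Rightarrow> bool" where
  "convex_body K \<longleftrightarrow> compact K \<and> convex K \<and> interior K \<noteq> {}"

definition supporting_hyperplane :: "'a::euclidean_space set \<Rightarrow> 'a set \<Rightarrow> bool" where
  "supporting_hyperplane K H \<longleftrightarrow>
     (\<exists>a b. a \<noteq> 0 \<and> H = {x. a \<bullet> x = b}) \<and> H \<inter> K \<noteq> {} \<and> H \<inter> interior K = {}"

definition orth_supporting_hyperplanes :: "'a::euclidean_space set \<Rightarrow> 'a \<Rightarrow> 'a set set" where
  "orth_supporting_hyperplanes K u = {H. supporting_hyperplane K H \<and> (\<exists>b. H = {x. u \<bullet> x = b})}"

(* The two supporting hyperplanes orthogonal to u, in an arbitrary order; everything below is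
   symmetric in them.  For a convex body and u \<noteq> 0 the pair exists: see
   orth_supporting_hyperplanes_eq and supp_hyp_pair below. *)
definition supp_hyps :: "'a::euclidean_space set \<Rightarrow> 'a \<Rightarrow> 'a set \<times> 'a set" where
  "supp_hyps K u =
     (SOME P. fst P \<noteq> snd P \<and> orth_supporting_hyperplanes K u = {fst P, snd P})"

definition supp_hyp1 :: "'a::euclidean_space set \<Rightarrow> 'a \<Rightarrow> 'a set" where
  "supp_hyp1 K u = fst (supp_hyps K u)"

definition supp_hyp2 :: "'a::euclidean_space set \<Rightarrow> 'a \<Rightarrow> 'a set" where
  "supp_hyp2 K u = snd (supp_hyps K u)"

definition width :: "'a::euclidean_space set \<Rightarrow> 'a \<Rightarrow> real" where
  "width K u = setdist (supp_hyp1 K u) (supp_hyp2 K u)"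

(* The supremum is attained for a convex body and u \<noteq> 0, see max_chord_attained below. *)
definition max_chord :: "'a::euclidean_space set \<Rightarrow> 'a \<Rightarrow> real" where
  "max_chord K u = (SUP (A, B) \<in> (K \<inter> supp_hyp1 K u) \<times> (K \<inter> supp_hyp2 K u). dist A B)"

definition p_fun :: "'a::euclidean_space set \<Rightarrow> 'a \<Rightarrow> real" where
  "p_fun K u = sqrt ((max_chord K u)\<^sup>2 - (width K u)\<^sup>2)"

(* A supremum of reals, bounded by the diameter of a convex body K; it is a maximum because
   p_fun K is upper semicontinuous on the sphere. *)
definition M_hat :: "'a::euclidean_space set \<Rightarrow> real" where
  "M_hat K = (SUP u \<in> sphere 0 1. p_fun K u)"

definition rho :: "'a::euclidean_space \<Rightarrow> 'a \<Rightarrow> real" where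
  "rho u v = arccos \<bar>u \<bullet> v\<bar>"

definition delta_width :: "'a::euclidean_space set \<Rightarrow> 'a \<Rightarrow> 'a \<Rightarrow> real" where
  "delta_width K u v = \<bar>width K u - width K v\<bar> / rho u v"

definition nonparallel_pairs :: "('a::euclidean_space \<times> 'a) set" where
  "nonparallel_pairs = {(u, v). u \<in> sphere 0 1 \<and> v \<in> sphere 0 1 \<and> u \<noteq> v \<and> u \<noteq> - v}"

(* Extended real, so that finiteness of the upper limit is not presupposed. *)
definition width_deriv :: "'a::euclidean_space set \<Rightarrow> 'a \<Rightarrow> ereal" where
  "width_deriv K u =
     Limsup (at (u, u) within nonparallel_pairs) (\<lambda>(u', u''). ereal (delta_width K u' u''))"

lemma convex_body_between_interior:
  assumes "convex_body K" "c \<in> interior K" "y \<in> K" "u \<bullet> c < b" "b < u \<bullet> y"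
  shows "\<exists>x\<in>interior K. u \<bullet> x = b"
proof -
  define t where "t = (u \<bullet> y - b) / (u \<bullet> y - u \<bullet> c)"
  have t: "0 < t" "t \<le> 1" using assms by (auto simp: t_def field_simps)
  define x where "x = y - t *\<^sub>R (y - c)"
  have "x \<in> interior K"
    unfolding x_def using assms t mem_interior_convex_shrink[of K c y t]
    by (auto simp: convex_body_def)
  moreover have "t * (u \<bullet> y - u \<bullet> c) = u \<bullet> y - b"
    using assms by (simp add: t_def)
  hence "u \<bullet> x = b" by (simp add: x_def inner_diff_right)
  ultimately show ?thesis by blast
qed

lemma convex_body_max_hyperplane:
  fixes u :: "'a::euclidean_space"
  assumes K: "convex_body K" and u: "u \<noteq> 0"
  shows "{x. u \<bullet> x = (SUP y\<in>K. u \<bullet> y)} \<in> orth_supporting_hyperplanes K u"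
    and "\<And>c. c \<in> interior K \<Longrightarrow> u \<bullet> c < (SUP y\<in>K. u \<bullet> y)"
proof -
  have ne: "K \<noteq> {}" and cK: "compact K" using K interior_subset by (auto simp: convex_body_def)
  have "compact ((\<bullet>) u ` K)" by (intro compact_continuous_image cK continuous_intros)
  hence bdd: "bdd_above ((\<bullet>) u ` K)" by (simp add: bounded_imp_bdd_above compact_imp_bounded)
  obtain m where m: "m \<in> K" "\<And>y. y \<in> K \<Longrightarrow> u \<bullet> y \<le> u \<bullet> m"
    using continuous_attains_sup[OF cK ne continuous_on_inner[OF continuous_on_const continuous_on_id]]
    by blast
  have sup: "(SUP y\<in>K. u \<bullet> y) = u \<bullet> m"
    using m ne bdd by (intro antisym cSUP_least cSUP_upper) auto
  show lt: "u \<bullet> c < (SUP y\<in>K. u \<bullet> y)" if c: "c \<in> interior K" for c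
  proof -
    obtain e where e: "e > 0" "cball c e \<subseteq> K" using c by (auto simp: mem_interior_cball)
    have "c + (e / norm u) *\<^sub>R u \<in> K" using e u by (auto simp: subset_iff dist_norm)
    from m(2)[OF this] have "u \<bullet> c + (e / norm u) * (u \<bullet> u) \<le> u \<bullet> m"
      by (simp add: inner_add_right)
    moreover have "(e / norm u) * (u \<bullet> u) > 0" using e u by simp
    ultimately show ?thesis unfolding sup by linarith
  qed
  show "{x. u \<bullet> x = (SUP y\<in>K. u \<bullet> y)} \<in> orth_supporting_hyperplanes K u"
    using u m(1) sup lt unfolding orth_supporting_hyperplanes_def supporting_hyperplane_def
    by fastforce
qed

lemma orth_supporting_hyperplanes_uminus:
  "orth_supporting_hyperplanes K (- u) = orth_supporting_hyperplanes K u"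
proof -
  have "\<exists>b'. {x. u \<bullet> x = b} = {x. - u \<bullet> x = b'}" for b by (rule exI[of _ "- b"]) auto
  moreover have "\<exists>b'. {x. - u \<bullet> x = b} = {x. u \<bullet> x = b'}" for b by (rule exI[of _ "- b"]) auto
  ultimately show ?thesis unfolding orth_supporting_hyperplanes_def by metis
qed

lemma orth_supporting_hyperplanes_eq:
  fixes u :: "'a::euclidean_space"
  assumes K: "convex_body K" and u: "u \<noteq> 0"
  shows "orth_supporting_hyperplanes K u =
           {{x. u \<bullet> x = (SUP y\<in>K. u \<bullet> y)}, {x. u \<bullet> x = (INF y\<in>K. u \<bullet> y)}}" (is "_ = {?S, ?I}")
    and "(INF y\<in>K. u \<bullet> y) < (SUP y\<in>K. u \<bullet> y)"
proof -
  have ne: "K \<noteq> {}" using K interior_subset by (auto simp: convex_body_def)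
  have inf: "(INF y\<in>K. u \<bullet> y) = - (SUP y\<in>K. - u \<bullet> y)"
    by (simp add: Inf_real_def image_image)
  have I: "?I = {x. - u \<bullet> x = (SUP y\<in>K. - u \<bullet> y)}" unfolding inf by auto
  have mem: "?S \<in> orth_supporting_hyperplanes K u" "?I \<in> orth_supporting_hyperplanes K u"
    using convex_body_max_hyperplane(1)[OF K u] convex_body_max_hyperplane(1)[OF K, of "- u"] u
    unfolding I orth_supporting_hyperplanes_uminus[of K u] by simp_all
  obtain c where c: "c \<in> interior K" using K by (auto simp: convex_body_def)
  show "(INF y\<in>K. u \<bullet> y) < (SUP y\<in>K. u \<bullet> y)"
    using convex_body_max_hyperplane(2)[OF K u c] convex_body_max_hyperplane(2)[OF K _ c, of "- u"] u
    unfolding inf by simp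
  have "H \<in> {?S, ?I}" if H: "H \<in> orth_supporting_hyperplanes K u" for H
  proof -
    obtain b where b: "H = {x. u \<bullet> x = b}" and d: "H \<inter> K \<noteq> {}" "H \<inter> interior K = {}"
      using H by (auto simp: orth_supporting_hyperplanes_def supporting_hyperplane_def)
    obtain z where z: "z \<in> K" "u \<bullet> z = b" using b d by auto
    have "u \<bullet> c \<noteq> b" using b d c by auto
    then consider "u \<bullet> c < b" | "- u \<bullet> c < - b" by force
    thus ?thesis
    proof cases
      case 1
      have "u \<bullet> y \<le> b" if "y \<in> K" for y
        using convex_body_between_interior[OF K c that 1] b d by force
      hence "(SUP y\<in>K. u \<bullet> y) = b" using z by (intro cSup_eq_maximum) auto
      thus ?thesis using b by simp
    next
      case 2
      have "b \<le> u \<bullet> y" if "y \<in> K" for y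
        using convex_body_between_interior[OF K c that 2] b d by force
      hence "(INF y\<in>K. u \<bullet> y) = b" using z by (intro cInf_eq_minimum) auto
      thus ?thesis using b by simp
    qed
  qed
  thus "orth_supporting_hyperplanes K u = {?S, ?I}" using mem by blast
qed

lemma supp_hyp_pair:
  fixes u :: "'a::euclidean_space"
  assumes K: "convex_body K" and u: "u \<noteq> 0"
  shows "supp_hyp1 K u \<noteq> supp_hyp2 K u"
    and "orth_supporting_hyperplanes K u = {supp_hyp1 K u, supp_hyp2 K u}"
proof -
  let ?S = "{x. u \<bullet> x = (SUP y\<in>K. u \<bullet> y)}" and ?I = "{x. u \<bullet> x = (INF y\<in>K. u \<bullet> y)}"
  have "?S \<in> orth_supporting_hyperplanes K u"
    using orth_supporting_hyperplanes_eq(1)[OF K u] by blast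
  then obtain x where "x \<in> ?S"
    by (auto simp: orth_supporting_hyperplanes_def supporting_hyperplane_def)
  hence "?S \<noteq> ?I" using orth_supporting_hyperplanes_eq(2)[OF K u] by auto
  hence "fst (?S, ?I) \<noteq> snd (?S, ?I) \<and>
         orth_supporting_hyperplanes K u = {fst (?S, ?I), snd (?S, ?I)}"
    using orth_supporting_hyperplanes_eq(1)[OF K u] by simp
  from someI[of "\<lambda>P. fst P \<noteq> snd P \<and> orth_supporting_hyperplanes K u = {fst P, snd P}", OF this]
  show "supp_hyp1 K u \<noteq> supp_hyp2 K u"
    and "orth_supporting_hyperplanes K u = {supp_hyp1 K u, supp_hyp2 K u}"
    by (simp_all add: supp_hyps_def supp_hyp1_def supp_hyp2_def)
qed

lemma max_chord_attained:
  fixes u :: "'a::euclidean_space"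
  assumes K: "convex_body K" and u: "u \<noteq> 0"
  shows "\<exists>A \<in> K \<inter> supp_hyp1 K u. \<exists>B \<in> K \<inter> supp_hyp2 K u. max_chord K u = dist A B \<and>
           (\<forall>A' \<in> K \<inter> supp_hyp1 K u. \<forall>B' \<in> K \<inter> supp_hyp2 K u. dist A' B' \<le> dist A B)"
proof -
  have hyp: "compact (K \<inter> H) \<and> K \<inter> H \<noteq> {}" if "H \<in> orth_supporting_hyperplanes K u" for H
  proof -
    have "closed H" using that by (auto simp: orth_supporting_hyperplanes_def closed_hyperplane)
    thus ?thesis using that K
      by (auto simp: convex_body_def orth_supporting_hyperplanes_def supporting_hyperplane_def
               intro: compact_Int_closed)
  qed
  define P where "P = (K \<inter> supp_hyp1 K u) \<times> (K \<inter> supp_hyp2 K u)"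
  have "compact P" "P \<noteq> {}"
    using hyp[of "supp_hyp1 K u"] hyp[of "supp_hyp2 K u"] supp_hyp_pair(2)[OF K u]
    by (auto simp: P_def intro: compact_Times)
  moreover have "continuous_on P (\<lambda>z. dist (fst z) (snd z))" by (intro continuous_intros)
  ultimately obtain z where z: "z \<in> P" "\<And>y. y \<in> P \<Longrightarrow> dist (fst y) (snd y) \<le> dist (fst z) (snd z)"
    using continuous_attains_sup[of P "\<lambda>z. dist (fst z) (snd z)"] by auto
  have "max_chord K u = dist (fst z) (snd z)"
    unfolding max_chord_def P_def[symmetric] case_prod_beta
    using z by (intro cSup_eq_maximum) auto
  thus ?thesis using z by (force simp: P_def)
qed

end

(* Let D = K - K, so that the width in a unit direction u is the maximum of <u, z> over z in D,
   and p(u) is the largest length of the component orthogonal to u of a maximiser z.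
   Let c be a unit-speed great circle and z a maximiser for c(t).  Comparing w(c(s)) with
   <c(s), z> gives w(c(t)) - w(c(s)) <= |s - t| p(c(t)) + O((s - t)^2).
   Together with the upper semicontinuity of p this yields the local statement; summing over a
   fine subdivision of the arc between u and v makes the quadratic error disappear and yields
   the global one. *)
theory Submission
  imports Defs
begin

section \<open>Width and longest chord expressed through differences \<open>A - B\<close> of points
  of \<open>K\<close>\<close>

lemma setdist_parallel_hyperplanes:
  fixes u :: "'a::euclidean_space"
  assumes u: "norm u = 1"
  shows "setdist {x. u \<bullet> x = a} {x. u \<bullet> x = b} = \<bar>a - b\<bar>"
proof (rule antisym)
  have uu: "u \<bullet> u = 1" using u by (simp add: norm_eq_1)
  have "setdist {x. u \<bullet> x = a} {x. u \<bullet> x = b} \<le> dist (a *\<^sub>R u) (b *\<^sub>R u)"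
    by (rule setdist_le_dist) (simp_all add: uu)
  also have "\<dots> = \<bar>a - b\<bar>"
    using u by (simp add: dist_norm flip: scaleR_diff_left)
  finally show "setdist {x. u \<bullet> x = a} {x. u \<bullet> x = b} \<le> \<bar>a - b\<bar>" .
  have ne: "a *\<^sub>R u \<in> {x. u \<bullet> x = a}" "b *\<^sub>R u \<in> {x. u \<bullet> x = b}" by (simp_all add: uu)
  show "\<bar>a - b\<bar> \<le> setdist {x. u \<bullet> x = a} {x. u \<bullet> x = b}"
  proof (rule le_setdistI)
    show "\<bar>a - b\<bar> \<le> dist x y" if "x \<in> {x. u \<bullet> x = a}" "y \<in> {x. u \<bullet> x = b}" for x y
      using Cauchy_Schwarz_ineq2[of u "x - y"] that u by (simp add: dist_norm inner_diff_right)
  qed (use ne in blast)+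
qed

text \<open>\<open>supp_hyps\<close> chooses an ordered pair, so it is not known which component is
  the upper hyperplane. Later arguments split on the two possible orders here.\<close>

lemma supp_hyp_cases:
  fixes u :: "'a::euclidean_space"
  assumes "convex_body K" and "u \<noteq> 0"
  obtains "supp_hyp1 K u = {x. u \<bullet> x = (SUP y\<in>K. u \<bullet> y)}" "supp_hyp2 K u = {x. u \<bullet> x = (INF y\<in>K. u \<bullet> y)}"
  | "supp_hyp1 K u = {x. u \<bullet> x = (INF y\<in>K. u \<bullet> y)}" "supp_hyp2 K u = {x. u \<bullet> x = (SUP y\<in>K. u \<bullet> y)}"
  using supp_hyp_pair(2)[OF assms] orth_supporting_hyperplanes_eq(1)[OF assms]
  by (auto simp: doubleton_eq_iff)

lemma width_eq_SUP_diff_INF: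
  fixes u :: "'a::euclidean_space"
  assumes K: "convex_body K" and u: "norm u = 1"
  shows "width K u = (SUP y\<in>K. u \<bullet> y) - (INF y\<in>K. u \<bullet> y)"
proof -
  have u0: "u \<noteq> 0" using u by auto
  show ?thesis
    using orth_supporting_hyperplanes_eq(2)[OF K u0]
    by (cases rule: supp_hyp_cases[OF K u0]) (simp_all add: width_def setdist_parallel_hyperplanes u)
qed

lemma inner_le_SUP_convex_body:
  assumes "convex_body K" and "A \<in> K"
  shows "u \<bullet> A \<le> (SUP y\<in>K. u \<bullet> y)" and "(INF y\<in>K. u \<bullet> y) \<le> u \<bullet> A"
proof -
  have "compact ((\<bullet>) u ` K)"
    using assms by (auto simp: convex_body_def intro!: compact_continuous_image continuous_intros)
  hence "bdd_above ((\<bullet>) u ` K)" "bdd_below ((\<bullet>) u ` K)"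
    by (simp_all add: bounded_imp_bdd_above bounded_imp_bdd_below compact_imp_bounded)
  thus "u \<bullet> A \<le> (SUP y\<in>K. u \<bullet> y)" "(INF y\<in>K. u \<bullet> y) \<le> u \<bullet> A"
    using assms(2) by (auto intro: cSUP_upper cINF_lower)
qed

text \<open>Together with \<open>max_chord_witness\<close> this identifies the width in a unit
  direction as the support function of the difference body of \<open>K\<close>.\<close>

lemma inner_diff_le_width:
  fixes u :: "'a::euclidean_space"
  assumes "convex_body K" "norm u = 1" "A \<in> K" "B \<in> K"
  shows "u \<bullet> (A - B) \<le> width K u"
  using inner_le_SUP_convex_body(1)[OF assms(1,3), of u] inner_le_SUP_convex_body(2)[OF assms(1,4), of u]
  by (simp add: width_eq_SUP_diff_INF assms inner_diff_right)

text \<open>Equality leaves no slack in either bound, so \<open>A\<close> lies on the upper and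
  \<open>B\<close> on the lower supporting hyperplane, and the pair competes in the maximum.\<close>

lemma norm_diff_le_max_chord:
  fixes u :: "'a::euclidean_space"
  assumes K: "convex_body K" and u: "norm u = 1" and AB: "A \<in> K" "B \<in> K"
    and eq: "u \<bullet> (A - B) = width K u"
  shows "norm (A - B) \<le> max_chord K u"
proof -
  have u0: "u \<noteq> 0" using u by auto
  have "u \<bullet> A = (SUP y\<in>K. u \<bullet> y)" "u \<bullet> B = (INF y\<in>K. u \<bullet> y)"
    using inner_le_SUP_convex_body(1)[OF K AB(1), of u] inner_le_SUP_convex_body(2)[OF K AB(2), of u] eq
    by (simp_all add: width_eq_SUP_diff_INF K u inner_diff_right)
  thus ?thesis
    using max_chord_attained[OF K u0] AB
    by (cases rule: supp_hyp_cases[OF K u0])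
       (fastforce simp: dist_norm norm_minus_commute)+
qed

lemma max_chord_witness:
  fixes u :: "'a::euclidean_space"
  assumes K: "convex_body K" and u: "norm u = 1"
  obtains A B where "A \<in> K" "B \<in> K" "u \<bullet> (A - B) = width K u" "norm (A - B) = max_chord K u"
proof -
  have u0: "u \<noteq> 0" using u by auto
  obtain A B where AB: "A \<in> K \<inter> supp_hyp1 K u" "B \<in> K \<inter> supp_hyp2 K u" "max_chord K u = dist A B"
    using max_chord_attained[OF K u0] by blast
  show thesis
  proof (cases rule: supp_hyp_cases[OF K u0])
    case 1
    show thesis by (rule that[of A B]) (use AB 1 in \<open>auto simp: width_eq_SUP_diff_INF K u inner_diff_right dist_norm\<close>)
  next
    case 2
    \<comment> \<open>The first hyperplane is the lower one here, so the endpoints are swapped to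
      make \<open>u \<bullet> (A - B)\<close> positive.\<close>
    show thesis by (rule that[of B A])
        (use AB 2 in \<open>auto simp: width_eq_SUP_diff_INF K u inner_diff_right dist_norm norm_minus_commute\<close>)
  qed
qed

lemma width_nonneg: "width K u \<ge> 0"
  by (simp add: width_def)

lemma width_uminus: "width K (- u) = width K u"
  by (simp add: width_def supp_hyp1_def supp_hyp2_def supp_hyps_def orth_supporting_hyperplanes_uminus)

lemma width_le_max_chord:
  fixes u :: "'a::euclidean_space"
  assumes "convex_body K" "norm u = 1"
  shows "width K u \<le> max_chord K u"
proof -
  obtain A B where "u \<bullet> (A - B) = width K u" "norm (A - B) = max_chord K u"
    using max_chord_witness[OF assms] by metis
  thus ?thesis using norm_cauchy_schwarz[of u "A - B"] assms by simp
qed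

lemma max_chord_le_diameter:
  fixes u :: "'a::euclidean_space"
  assumes K: "convex_body K" and u: "norm u = 1"
  shows "max_chord K u \<le> diameter K"
proof -
  obtain A B where "A \<in> K" "B \<in> K" "norm (A - B) = max_chord K u"
    using max_chord_witness[OF assms] by metis
  thus ?thesis using diameter_bounded_bound[of K A B] K
    by (simp add: convex_body_def compact_imp_bounded dist_norm)
qed

text \<open>Both claims rest on a nonnegative radicand: at a negative argument \<open>sqrt\<close>
  is negative and its square has the wrong sign.\<close>

lemma p_fun_power2:
  fixes u :: "'a::euclidean_space"
  assumes "convex_body K" "norm u = 1"
  shows "(p_fun K u)\<^sup>2 = (max_chord K u)\<^sup>2 - (width K u)\<^sup>2" and "p_fun K u \<ge> 0"
proof -
  have "(width K u)\<^sup>2 \<le> (max_chord K u)\<^sup>2"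
    using width_le_max_chord[OF assms] by (simp add: power_mono width_nonneg)
  thus "(p_fun K u)\<^sup>2 = (max_chord K u)\<^sup>2 - (width K u)\<^sup>2" "p_fun K u \<ge> 0"
    by (simp_all add: p_fun_def)
qed

text \<open>Supplies the upper bound without which the real supremum in \<open>M_hat\<close> could
  not be compared with its members.\<close>

lemma p_fun_le_diameter:
  fixes u :: "'a::euclidean_space"
  assumes K: "convex_body K" and u: "norm u = 1"
  shows "p_fun K u \<le> diameter K"
proof -
  have "(p_fun K u)\<^sup>2 \<le> (max_chord K u)\<^sup>2" by (simp add: p_fun_power2 assms)
  moreover have "max_chord K u \<ge> 0"
    using width_le_max_chord[OF assms] width_nonneg[of K u] by linarith
  ultimately have "p_fun K u \<le> max_chord K u" by (rule power2_le_imp_le)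
  thus ?thesis using max_chord_le_diameter[OF assms] by linarith
qed

lemma p_fun_le_M_hat:
  fixes u :: "'a::euclidean_space"
  assumes "convex_body K" "norm u = 1"
  shows "p_fun K u \<le> M_hat K"
  unfolding M_hat_def
proof (rule cSUP_upper)
  show "u \<in> sphere 0 1" using assms by simp
  show "bdd_above (p_fun K ` sphere 0 1)"
    by (rule bdd_aboveI2[of _ _ "diameter K"]) (simp add: p_fun_le_diameter assms)
qed

section \<open>Variation of the width along a great circle\<close>

text \<open>Bessel's inequality for an orthonormal pair: the remainder \<open>q\<close> of
  \<open>z\<close> after projection has nonnegative square.\<close>

lemma inner_power2_add_le:
  fixes u e z :: "'a::real_inner"
  assumes u: "norm u = 1" and e: "norm e = 1" and ue: "u \<bullet> e = 0"
  shows "(u \<bullet> z)\<^sup>2 + (e \<bullet> z)\<^sup>2 \<le> (norm z)\<^sup>2"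
proof -
  define q where "q = z - (u \<bullet> z) *\<^sub>R u - (e \<bullet> z) *\<^sub>R e"
  have "u \<bullet> u = 1" "e \<bullet> e = 1" using u e by (simp_all add: norm_eq_1)
  hence "q \<bullet> q = z \<bullet> z - (u \<bullet> z)\<^sup>2 - (e \<bullet> z)\<^sup>2"
    using ue by (simp add: q_def inner_diff inner_commute power2_eq_square algebra_simps)
  moreover have "q \<bullet> q \<ge> 0" by simp
  ultimately show ?thesis by (simp add: power2_norm_eq_inner)
qed

lemma one_minus_cos_le: "1 - cos d \<le> d\<^sup>2 / 2" for d :: real
proof -
  have "(sin (d / 2))\<^sup>2 \<le> (d / 2)\<^sup>2"
    using abs_sin_x_le_abs_x[of "d / 2"] by (simp only: abs_le_square_iff)
  thus ?thesis using cos_double_sin[of "d / 2"] by (simp add: power_divide)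
qed

text \<open>The longest chord for \<open>u\<close> is tested against the rotated direction. Its
  component along \<open>e\<close> costs at most \<open>\<bar>d\<bar> * p_fun K u\<close>, and the
  shrinking factor \<open>cos d\<close> costs at most the quadratic term.\<close>

lemma width_diff_le_rotation:
  fixes u e :: "'a::euclidean_space"
  assumes K: "convex_body K" and u: "norm u = 1" and e: "norm e = 1" and ue: "u \<bullet> e = 0"
    and v: "norm (cos d *\<^sub>R u + sin d *\<^sub>R e) = 1"
  shows "width K u - width K (cos d *\<^sub>R u + sin d *\<^sub>R e) \<le> \<bar>d\<bar> * p_fun K u + diameter K / 2 * d\<^sup>2"
proof -
  obtain A B where AB: "A \<in> K" "B \<in> K" "u \<bullet> (A - B) = width K u" "norm (A - B) = max_chord K u"
    using max_chord_witness[OF K u] by metis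
  \<comment> \<open>The component of \<open>A - B\<close> along \<open>u\<close> is the width, so
    Bessel's inequality leaves exactly the square of \<open>p_fun K u\<close> for the component
    along \<open>e\<close>.\<close>
  have "\<bar>e \<bullet> (A - B)\<bar>\<^sup>2 \<le> (p_fun K u)\<^sup>2"
    using inner_power2_add_le[OF u e ue, of "A - B"] unfolding AB(3,4) p_fun_power2(1)[OF K u] by simp
  hence "\<bar>e \<bullet> (A - B)\<bar> \<le> p_fun K u"
    using p_fun_power2(2)[OF K u] by (rule power2_le_imp_le)
  hence 1: "\<bar>sin d\<bar> * \<bar>e \<bullet> (A - B)\<bar> \<le> \<bar>d\<bar> * p_fun K u"
    by (intro mult_mono abs_sin_x_le_abs_x) auto
  have "(1 - cos d) * width K u \<le> d\<^sup>2 / 2 * diameter K"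
    using width_le_max_chord[OF K u] max_chord_le_diameter[OF K u]
    by (intro mult_mono one_minus_cos_le) (auto simp: width_nonneg)
  moreover have "cos d * width K u + sin d * (e \<bullet> (A - B)) \<le> width K (cos d *\<^sub>R u + sin d *\<^sub>R e)"
    using inner_diff_le_width[OF K v AB(1,2)] AB(3) by (simp add: inner_add_left)
  moreover have "- (sin d * (e \<bullet> (A - B))) \<le> \<bar>sin d\<bar> * \<bar>e \<bullet> (A - B)\<bar>"
    by (metis abs_ge_minus_self abs_mult)
  ultimately show ?thesis using 1 by (simp add: algebra_simps)
qed

lemma norm_cos_sin:
  fixes u e :: "'a::real_inner"
  assumes "norm u = 1" "norm e = 1" "u \<bullet> e = 0"
  shows "norm (cos t *\<^sub>R u + sin t *\<^sub>R e) = 1"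
proof -
  have "u \<bullet> u = 1" "e \<bullet> e = 1" "e \<bullet> u = 0" using assms by (simp_all add: norm_eq_1 inner_commute)
  hence "(cos t *\<^sub>R u + sin t *\<^sub>R e) \<bullet> (cos t *\<^sub>R u + sin t *\<^sub>R e) = (cos t)\<^sup>2 + (sin t)\<^sup>2"
    using assms(3) by (simp add: inner_add power2_eq_square)
  thus ?thesis by (simp add: norm_eq_1)
qed

text \<open>The rotation estimate is recentred at \<open>c t\<close>: the point \<open>c s\<close>
  arises from \<open>c t\<close> by rotation through \<open>s - t\<close>.\<close>

lemma width_diff_le_great_circle:
  fixes u e :: "'a::euclidean_space"
  assumes K: "convex_body K" and u: "norm u = 1" and e: "norm e = 1" and ue: "u \<bullet> e = 0"
  defines "c \<equiv> \<lambda>t. cos t *\<^sub>R u + sin t *\<^sub>R e"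
  shows "width K (c t) - width K (c s) \<le> \<bar>s - t\<bar> * p_fun K (c t) + diameter K / 2 * (s - t)\<^sup>2"
proof -
  \<comment> \<open>This is the derivative of \<open>c\<close> at \<open>t\<close>, written as a
    combination of \<open>e\<close> and \<open>- u\<close> so that \<open>norm_cos_sin\<close>
    applies.\<close>
  define e' where "e' = cos t *\<^sub>R e + sin t *\<^sub>R (- u)"
  have eu: "e \<bullet> - u = 0" and uu: "norm (- u) = 1" using u ue by (simp_all add: inner_commute)
  have nc: "norm (c r) = 1" for r unfolding c_def by (rule norm_cos_sin[OF u e ue])
  have ne: "norm e' = 1" unfolding e'_def by (rule norm_cos_sin[OF e uu eu])
  have ce: "c t \<bullet> e' = 0"
    using u e ue by (simp add: c_def e'_def inner_add inner_diff inner_commute norm_eq_1)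
  have cs: "c s = cos (s - t) *\<^sub>R c t + sin (s - t) *\<^sub>R e'"
  proof -
    have "cos (s - t) *\<^sub>R c t + sin (s - t) *\<^sub>R e' =
       (cos (s - t) * cos t - sin (s - t) * sin t) *\<^sub>R u + (cos (s - t) * sin t + sin (s - t) * cos t) *\<^sub>R e"
      by (simp add: c_def e'_def algebra_simps)
    also have "\<dots> = cos ((s - t) + t) *\<^sub>R u + sin ((s - t) + t) *\<^sub>R e"
      by (simp only: cos_add sin_add add.commute mult.commute)
    finally show ?thesis by (simp add: c_def)
  qed
  show ?thesis
    using width_diff_le_rotation[OF K nc ne ce, of "s - t"] nc[of s] unfolding cs[symmetric] .
qed

text \<open>Cutting the interval into \<open>Suc n\<close> equal steps keeps the total linear term
  and divides the total quadratic error by \<open>Suc n\<close>; then \<open>n\<close> tends to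
  infinity.\<close>

lemma lipschitz_if_quadratic_error:
  fixes g :: "real \<Rightarrow> real"
  assumes g: "\<And>s t. g t - g s \<le> P * \<bar>s - t\<bar> + C * (s - t)\<^sup>2"
  shows "\<bar>g b - g a\<bar> \<le> P * \<bar>b - a\<bar>"
proof -
  \<comment> \<open>The bound is symmetric in \<open>s\<close> and \<open>t\<close>, so exchanging
    them makes the one-sided hypothesis two-sided.\<close>
  have *: "\<bar>g t - g s\<bar> \<le> P * \<bar>s - t\<bar> + C * (s - t)\<^sup>2" for s t
    using g[of t s] g[of s t] by (simp add: abs_le_iff abs_minus_commute power2_commute)
  have step: "\<bar>g (a + real k * h) - g a\<bar> \<le> real k * (P * \<bar>h\<bar> + C * h\<^sup>2)" for k h
  proof (induction k)
    case (Suc k)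
    have "\<bar>g (a + real (Suc k) * h) - g (a + real k * h)\<bar> \<le> P * \<bar>h\<bar> + C * h\<^sup>2"
      using *[of "a + real (Suc k) * h" "a + real k * h"] by (simp add: algebra_simps)
    with Suc show ?case by (simp add: algebra_simps)
  qed simp
  have bound: "\<bar>g b - g a\<bar> \<le> P * \<bar>b - a\<bar> + C * (b - a)\<^sup>2 * inverse (real (Suc n))" for n
  proof -
    have "\<bar>g b - g a\<bar> \<le> real (Suc n) * (P * \<bar>(b - a) / real (Suc n)\<bar> + C * ((b - a) / real (Suc n))\<^sup>2)"
      using step[of "Suc n" "(b - a) / real (Suc n)"] by (simp del: of_nat_Suc)
    also have "\<dots> = P * \<bar>b - a\<bar> + C * (b - a)\<^sup>2 * inverse (real (Suc n))"
      by (simp add: abs_divide power2_eq_square field_simps del: of_nat_Suc)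
    finally show ?thesis .
  qed
  have "(\<lambda>n. P * \<bar>b - a\<bar> + C * (b - a)\<^sup>2 * inverse (real (Suc n)))
          \<longlonglongrightarrow> P * \<bar>b - a\<bar> + C * (b - a)\<^sup>2 * 0"
    by (intro tendsto_intros LIMSEQ_inverse_real_of_nat)
  thus ?thesis using bound by (intro LIMSEQ_le_const[where X = "\<lambda>n. P * \<bar>b - a\<bar> + C * (b - a)\<^sup>2 * inverse (real (Suc n))"]) auto
qed

section \<open>Bounds for the difference quotient \<open>delta_width\<close>\<close>

text \<open>Gram-Schmidt: \<open>e\<close> is the normalised part of \<open>v\<close> orthogonal to
  \<open>u\<close>. For a nonnegative inner product the absolute value in \<open>rho\<close>
  disappears, so \<open>rho u v\<close> is the actual angle.\<close>

lemma great_circle_through: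
  fixes u v :: "'a::euclidean_space"
  assumes uv: "(u, v) \<in> nonparallel_pairs" and pos: "u \<bullet> v \<ge> 0"
  obtains e where "norm e = 1" "u \<bullet> e = 0" "v = cos (rho u v) *\<^sub>R u + sin (rho u v) *\<^sub>R e"
proof -
  have n: "norm u = 1" "norm v = 1" and ne: "u \<noteq> v" "u \<noteq> - v"
    using uv by (auto simp: nonparallel_pairs_def)
  hence i: "u \<bullet> u = 1" "v \<bullet> v = 1" by (simp_all add: norm_eq_1)
  define x where "x = u \<bullet> v"
  \<comment> \<open>Expanded for unit vectors this reads \<open>2 - 2 * x > 0\<close>.\<close>
  have "(u - v) \<bullet> (u - v) > 0" using ne by simp
  hence x: "0 \<le> x" "x < 1" using i pos by (simp_all add: x_def inner_diff inner_commute)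
  hence x2: "x\<^sup>2 < 1" by (simp add: abs_square_less_1)
  define r where "r = sqrt (1 - x\<^sup>2)"
  have r: "r > 0" "r\<^sup>2 = 1 - x\<^sup>2" using x2 by (simp_all add: r_def)
  have cs: "cos (rho u v) = x" "sin (rho u v) = r"
    using x by (simp_all add: rho_def r_def sin_arccos flip: x_def)
  define e where "e = (1 / r) *\<^sub>R (v - x *\<^sub>R u)"
  have "(v - x *\<^sub>R u) \<bullet> (v - x *\<^sub>R u) = r\<^sup>2"
    using i r by (simp add: inner_diff inner_commute x_def power2_eq_square)
  hence "norm (v - x *\<^sub>R u) = r" using r(1) by (simp add: norm_eq_sqrt_inner)
  hence "norm e = 1" using r by (simp add: e_def)
  moreover have "u \<bullet> e = 0" using i by (simp add: e_def inner_diff_right x_def)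
  moreover have "v = cos (rho u v) *\<^sub>R u + sin (rho u v) *\<^sub>R e"
    using r unfolding cs by (simp add: e_def)
  ultimately show thesis using that by blast
qed

lemma rho_pos:
  fixes u v :: "'a::euclidean_space"
  assumes "(u, v) \<in> nonparallel_pairs"
  shows "rho u v > 0"
proof -
  have n: "norm u = 1" "norm v = 1" and ne: "u \<noteq> v" "u \<noteq> - v"
    using assms by (auto simp: nonparallel_pairs_def)
  hence i: "u \<bullet> u = 1" "v \<bullet> v = 1" by (simp_all add: norm_eq_1)
  have "(u - v) \<bullet> (u - v) > 0" "(u + v) \<bullet> (u + v) > 0"
    using ne by (auto simp: eq_neg_iff_add_eq_0)
  hence "\<bar>u \<bullet> v\<bar> < 1" using i by (simp add: inner_diff inner_add inner_commute abs_less_iff)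
  hence "arccos 1 < arccos \<bar>u \<bullet> v\<bar>" by (intro arccos_less_arccos) auto
  thus ?thesis by (simp add: rho_def)
qed

lemma nonparallel_pairs_uminus:
  "(u, v) \<in> nonparallel_pairs \<Longrightarrow> (u, - v) \<in> nonparallel_pairs"
  by (auto simp: nonparallel_pairs_def)

lemma delta_width_uminus: "delta_width K u (- v) = delta_width K u v"
  by (simp add: delta_width_def width_uminus rho_def)

text \<open>\<open>M_hat K\<close> bounds \<open>p_fun K\<close> at every point of the arc, so it
  can serve as the uniform linear coefficient when the arc is subdivided.\<close>

lemma delta_width_le_M_hat:
  fixes u v :: "'a::euclidean_space"
  assumes K: "convex_body K" and uv: "(u, v) \<in> nonparallel_pairs"
  shows "delta_width K u v \<le> M_hat K"
proof -
  \<comment> \<open>An obtuse pair reduces to this case by passing from \<open>v\<close> to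
    \<open>- v\<close>, which changes neither the width nor \<open>rho\<close>.\<close>
  have main: "delta_width K u v \<le> M_hat K" if uv: "(u, v) \<in> nonparallel_pairs" and pos: "u \<bullet> v \<ge> 0" for v
  proof -
    obtain e where e: "norm e = 1" "u \<bullet> e = 0" "v = cos (rho u v) *\<^sub>R u + sin (rho u v) *\<^sub>R e"
      by (rule great_circle_through[OF uv pos])
    have u: "norm u = 1" using uv by (simp add: nonparallel_pairs_def)
    define g where "g t = width K (cos t *\<^sub>R u + sin t *\<^sub>R e)" for t
    have "g t - g s \<le> M_hat K * \<bar>s - t\<bar> + diameter K / 2 * (s - t)\<^sup>2" for s t
    proof -
      have "\<bar>s - t\<bar> * p_fun K (cos t *\<^sub>R u + sin t *\<^sub>R e) \<le> \<bar>s - t\<bar> * M_hat K"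
        by (intro mult_left_mono p_fun_le_M_hat K norm_cos_sin u e) auto
      thus ?thesis
        using width_diff_le_great_circle[OF K u e(1,2), of t s] by (simp add: g_def mult.commute)
    qed
    from lipschitz_if_quadratic_error[of g, OF this, of 0 "rho u v"]
    have "\<bar>width K u - width K v\<bar> \<le> M_hat K * rho u v"
      using rho_pos[OF uv] unfolding g_def e(3)[symmetric] by simp
    thus ?thesis using rho_pos[OF uv] by (simp add: delta_width_def pos_divide_le_eq)
  qed
  show ?thesis
    using main[OF uv] main[OF nonparallel_pairs_uminus[OF uv]]
    by (cases "u \<bullet> v \<ge> 0") (auto simp: delta_width_uminus)
qed

text \<open>A single step taken from each endpoint, without subdivision: only the values of
  \<open>p_fun\<close> at \<open>u\<close> and \<open>v\<close> enter, and after division by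
  \<open>rho u v\<close> the quadratic error becomes linear, hence negligible in the limit.\<close>

lemma delta_width_le_p_fun:
  fixes u v :: "'a::euclidean_space"
  assumes K: "convex_body K" and uv: "(u, v) \<in> nonparallel_pairs" and pos: "u \<bullet> v \<ge> 0"
  shows "delta_width K u v \<le> max (p_fun K u) (p_fun K v) + diameter K / 2 * rho u v"
proof -
  obtain e where e: "norm e = 1" "u \<bullet> e = 0" "v = cos (rho u v) *\<^sub>R u + sin (rho u v) *\<^sub>R e"
    by (rule great_circle_through[OF uv pos])
  have u: "norm u = 1" using uv by (simp add: nonparallel_pairs_def)
  have r: "rho u v > 0" by (rule rho_pos[OF uv])
  define p where "p = max (p_fun K u) (p_fun K v)"
  have "rho u v * p_fun K u \<le> rho u v * p" "rho u v * p_fun K v \<le> rho u v * p"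
    using r by (auto simp: p_def)
  moreover have "width K u - width K v \<le> rho u v * p_fun K u + diameter K / 2 * (rho u v)\<^sup>2"
    "width K v - width K u \<le> rho u v * p_fun K v + diameter K / 2 * (rho u v)\<^sup>2"
    using width_diff_le_great_circle[OF K u e(1,2), of 0 "rho u v"]
      width_diff_le_great_circle[OF K u e(1,2), of "rho u v" 0] r
    unfolding e(3)[symmetric] by simp_all
  ultimately have "\<bar>width K u - width K v\<bar> \<le> (p + diameter K / 2 * rho u v) * rho u v"
    by (simp add: abs_le_iff power2_eq_square algebra_simps)
  thus ?thesis using r by (simp add: delta_width_def pos_divide_le_eq p_def)
qed

section \<open>Continuity of the width and upper semicontinuity of \<open>p_fun\<close>\<close>

text \<open>The longest chord for one direction is tested against the other; its length is at most
  the diameter.\<close>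

lemma width_lipschitz:
  fixes u v :: "'a::euclidean_space"
  assumes K: "convex_body K" and "norm u = 1" "norm v = 1"
  shows "\<bar>width K u - width K v\<bar> \<le> diameter K * norm (u - v)"
proof -
  have *: "width K u - width K v \<le> diameter K * norm (u - v)"
    if u: "norm u = 1" and v: "norm v = 1" for u v
  proof -
    obtain A B where AB: "A \<in> K" "B \<in> K" "u \<bullet> (A - B) = width K u" "norm (A - B) = max_chord K u"
      using max_chord_witness[OF K u] by metis
    have "width K u - width K v \<le> (u - v) \<bullet> (A - B)"
      using inner_diff_le_width[OF K v AB(1,2)] AB(3) by (simp add: inner_diff_left)
    also have "\<dots> \<le> norm (u - v) * max_chord K u"
      using norm_cauchy_schwarz[of "u - v" "A - B"] AB(4) by simp
    also have "\<dots> \<le> norm (u - v) * diameter K"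
      by (intro mult_left_mono max_chord_le_diameter K u) auto
    finally show ?thesis by (simp add: mult.commute)
  qed
  show ?thesis using *[of u v] *[of v u] assms by (simp add: abs_le_iff norm_minus_commute)
qed

text \<open>By compactness, longest chords for a violating sequence of directions subconverge to a
  chord realising the width at \<open>u\<close>. Its length is at most \<open>max_chord K u\<close>,
  which contradicts the persistent gap \<epsilon>.\<close>

lemma p_fun_upper_semicontinuous:
  fixes u :: "'a::euclidean_space"
  assumes K: "convex_body K" and u: "norm u = 1" and "\<epsilon> > 0"
  obtains \<delta> where "\<delta> > 0" "\<And>v. norm v = 1 \<Longrightarrow> dist v u < \<delta> \<Longrightarrow> p_fun K v < p_fun K u + \<epsilon>"
proof -
  have "\<exists>\<delta>>0. \<forall>v. norm v = 1 \<longrightarrow> dist v u < \<delta> \<longrightarrow> p_fun K v < p_fun K u + \<epsilon>"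
  proof (rule ccontr)
    assume "\<not> ?thesis"
    moreover have "inverse (real (Suc n)) > 0" for n by simp
    ultimately have "\<forall>n. \<exists>v. norm v = 1 \<and> dist v u < inverse (real (Suc n)) \<and> p_fun K u + \<epsilon> \<le> p_fun K v"
      by (meson not_less)
    from choice[OF this] obtain v where v: "\<And>n. norm (v n) = 1"
      "\<And>n. dist (v n) u < inverse (real (Suc n))" "\<And>n. p_fun K u + \<epsilon> \<le> p_fun K (v n)" by blast
    have vu: "v \<longlonglongrightarrow> u"
    proof (rule metric_tendsto_imp_tendsto[OF LIMSEQ_inverse_real_of_nat])
      have "dist (v n) u \<le> dist (inverse (real (Suc n))) 0" for n
        using v(2)[of n] by (simp add: dist_real_def)
      thus "\<forall>\<^sub>F n in sequentially. dist (v n) u \<le> dist (inverse (real (Suc n))) 0"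
        by (rule always_eventually[OF allI])
    qed
    have "(\<lambda>n. width K (v n) - width K u) \<longlonglongrightarrow> 0"
    proof (rule Lim_null_comparison)
      show "\<forall>\<^sub>F n in sequentially. norm (width K (v n) - width K u) \<le> diameter K * norm (v n - u)"
        using width_lipschitz[OF K v(1) u] by simp
      show "(\<lambda>n. diameter K * norm (v n - u)) \<longlonglongrightarrow> 0"
        using vu by (intro tendsto_mult_right_zero tendsto_norm_zero LIM_zero)
    qed
    hence wl: "(\<lambda>n. width K (v n)) \<longlonglongrightarrow> width K u" by (rule LIM_zero_cancel)
    have "\<exists>z. z \<in> K \<times> K \<and> v n \<bullet> (fst z - snd z) = width K (v n)
        \<and> norm (fst z - snd z) = max_chord K (v n)" for n
      by (rule max_chord_witness[OF K v(1)[of n]]) force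
    hence "\<forall>n. \<exists>z. z \<in> K \<times> K \<and> v n \<bullet> (fst z - snd z) = width K (v n)
        \<and> norm (fst z - snd z) = max_chord K (v n)" by blast
    from choice[OF this] obtain z where z: "\<And>n. z n \<in> K \<times> K" "\<And>n. v n \<bullet> (fst (z n) - snd (z n)) = width K (v n)"
      "\<And>n. norm (fst (z n) - snd (z n)) = max_chord K (v n)" by blast
    have "compact (K \<times> K)" using K by (simp add: convex_body_def compact_Times)
    then obtain y r where y: "y \<in> K \<times> K" and r: "strict_mono r" and zy: "(z \<circ> r) \<longlonglongrightarrow> y"
      using z(1) unfolding compact_def by metis
    define Z where "Z = fst y - snd y"
    have Zl: "(\<lambda>n. fst (z (r n)) - snd (z (r n))) \<longlonglongrightarrow> Z"
      using zy unfolding Z_def o_def by (intro tendsto_intros)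
    have vl: "(\<lambda>n. v (r n)) \<longlonglongrightarrow> u" and wl': "(\<lambda>n. width K (v (r n))) \<longlonglongrightarrow> width K u"
      using LIMSEQ_subseq_LIMSEQ[OF vu r] LIMSEQ_subseq_LIMSEQ[OF wl r] by (simp_all add: o_def)
    have "(\<lambda>n. width K (v (r n))) \<longlonglongrightarrow> u \<bullet> Z"
      \<comment> \<open>The widths are the inner products with the chosen chords, so continuity of
        the width identifies \<open>u \<bullet> Z\<close> and lets the limit chord compete at
        \<open>u\<close>.\<close>
      using tendsto_inner[OF vl Zl] by (simp add: z(2))
    hence "u \<bullet> Z = width K u" using wl' LIMSEQ_unique by blast
    hence "norm Z \<le> max_chord K u"
      using norm_diff_le_max_chord[OF K u] y unfolding Z_def by auto
    hence "(norm Z)\<^sup>2 - (width K u)\<^sup>2 \<le> (p_fun K u)\<^sup>2"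
      by (simp add: p_fun_power2 K u power_mono)
    moreover have "(p_fun K u + \<epsilon>)\<^sup>2 \<le> (norm Z)\<^sup>2 - (width K u)\<^sup>2"
    proof (rule LIMSEQ_le_const)
      show "(\<lambda>n. (norm (fst (z (r n)) - snd (z (r n))))\<^sup>2 - (width K (v (r n)))\<^sup>2)
              \<longlonglongrightarrow> (norm Z)\<^sup>2 - (width K u)\<^sup>2"
        by (intro tendsto_intros Zl wl')
      have "(p_fun K u + \<epsilon>)\<^sup>2 \<le> (norm (fst (z (r n)) - snd (z (r n))))\<^sup>2 - (width K (v (r n)))\<^sup>2" for n
        using power_mono[OF v(3)[of "r n"], of 2] p_fun_power2[OF K v(1)[of "r n"]] \<open>\<epsilon> > 0\<close>
          p_fun_power2(2)[OF K u] z(3)[of "r n"] by simp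
      thus "\<exists>N. \<forall>n\<ge>N. (p_fun K u + \<epsilon>)\<^sup>2
              \<le> (norm (fst (z (r n)) - snd (z (r n))))\<^sup>2 - (width K (v (r n)))\<^sup>2" by blast
    qed
    moreover have "(p_fun K u)\<^sup>2 < (p_fun K u + \<epsilon>)\<^sup>2"
      using p_fun_power2(2)[OF K u] \<open>\<epsilon> > 0\<close> by (intro power_strict_mono) auto
    ultimately show False by linarith
  qed
  thus thesis using that by blast
qed

section \<open>The upper limit at a direction, and the conclusion\<close>

text \<open>Near \<open>(u, u)\<close> half of \<epsilon> absorbs the semicontinuity defect of
  \<open>p_fun\<close> at both points, the other half the error linear in
  \<open>rho\<close>.\<close>

lemma width_deriv_le_p_fun:
  fixes u :: "'a::euclidean_space"
  assumes K: "convex_body K" and u: "norm u = 1"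
  shows "width_deriv K u \<le> ereal (p_fun K u)"
proof (rule ereal_le_epsilon2)
  fix \<epsilon> :: real assume \<epsilon>: "0 < \<epsilon>"
  let ?F = "at (u, u) within nonparallel_pairs"
  obtain \<delta> where \<delta>: "\<delta> > 0" "\<And>v. norm v = 1 \<Longrightarrow> dist v u < \<delta> \<Longrightarrow> p_fun K v < p_fun K u + \<epsilon> / 2"
    using p_fun_upper_semicontinuous[OF K u, of "\<epsilon> / 2"] \<epsilon> by auto
  have id: "((\<lambda>z. z) \<longlongrightarrow> (u, u)) ?F" by (rule tendsto_ident_at)
  have f: "((\<lambda>z. fst z) \<longlongrightarrow> u) ?F" "((\<lambda>z. snd z) \<longlongrightarrow> u) ?F"
    using tendsto_fst[OF id] tendsto_snd[OF id] by simp_all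
  have "((\<lambda>z. fst z \<bullet> snd z) \<longlongrightarrow> u \<bullet> u) ?F" by (intro tendsto_intros f)
  hence ip: "((\<lambda>z. fst z \<bullet> snd z) \<longlongrightarrow> 1) ?F" using u by (simp add: norm_eq_1)
  have np: "\<forall>\<^sub>F z in ?F. z \<in> nonparallel_pairs"
    by (simp add: eventually_at_filter)
  have "((\<lambda>z. rho (fst z) (snd z)) \<longlongrightarrow> arccos 1) ?F"
    unfolding rho_def
  \<comment> \<open>The limit point 1 is an endpoint of the interval where \<open>arccos\<close> is
    continuous, so the arguments must be shown to stay inside it; Cauchy-Schwarz for unit vectors
    does this.\<close>
  proof (rule continuous_on_tendsto_compose[OF continuous_on_arccos'])
    show "((\<lambda>z. \<bar>fst z \<bullet> snd z\<bar>) \<longlongrightarrow> 1) ?F" using tendsto_rabs[OF ip] by simp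
    show "\<forall>\<^sub>F z in ?F. \<bar>fst z \<bullet> snd z\<bar> \<in> {-1..1}"
      using np
    proof (rule eventually_mono)
      fix z :: "'a \<times> 'a" assume "z \<in> nonparallel_pairs"
      thus "\<bar>fst z \<bullet> snd z\<bar> \<in> {-1..1}"
        using Cauchy_Schwarz_ineq2[of "fst z" "snd z"] by (auto simp: nonparallel_pairs_def)
    qed
  qed auto
  hence "((\<lambda>z. diameter K / 2 * rho (fst z) (snd z)) \<longlongrightarrow> 0) ?F"
    by (intro tendsto_mult_right_zero) simp
  hence "\<forall>\<^sub>F z in ?F. diameter K / 2 * rho (fst z) (snd z) < \<epsilon> / 2"
    using \<epsilon> by (intro order_tendstoD(2)) auto
  \<comment> \<open>Close to \<open>(u, u)\<close> the pair is acute, as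
    \<open>delta_width_le_p_fun\<close> requires.\<close>
  moreover have "\<forall>\<^sub>F z in ?F. fst z \<bullet> snd z > 0" using ip by (intro order_tendstoD(1)) auto
  moreover have "\<forall>\<^sub>F z in ?F. dist (fst z) u < \<delta>" "\<forall>\<^sub>F z in ?F. dist (snd z) u < \<delta>"
    using f \<delta>(1) by (auto dest: tendstoD)
  ultimately have "\<forall>\<^sub>F z in ?F. (case z of (u', u'') \<Rightarrow> ereal (delta_width K u' u'')) \<le> ereal (p_fun K u + \<epsilon>)"
    using np
  proof eventually_elim
    case (elim z)
    obtain a b where z: "z = (a, b)" by (cases z)
    have n: "norm a = 1" "norm b = 1" using elim(5) by (auto simp: nonparallel_pairs_def z)
    have "delta_width K a b \<le> max (p_fun K a) (p_fun K b) + diameter K / 2 * rho a b"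
      using elim by (intro delta_width_le_p_fun K) (auto simp: z)
    moreover have "p_fun K a < p_fun K u + \<epsilon> / 2" "p_fun K b < p_fun K u + \<epsilon> / 2"
      using \<delta>(2) n elim by (auto simp: z)
    ultimately show ?case using elim(1) by (simp add: z)
  qed
  hence "width_deriv K u \<le> ereal (p_fun K u + \<epsilon>)"
    unfolding width_deriv_def by (rule Limsup_bounded)
  thus "width_deriv K u \<le> ereal (p_fun K u) + ereal \<epsilon>" by simp
qed

theorem proposition14:
  fixes K :: "(real ^ 'n) set"
  assumes "CARD('n) \<ge> 2" and "convex_body K"
  shows "(SUP (u, v) \<in> nonparallel_pairs. ereal (delta_width K u v)) \<le> ereal (M_hat K)
       \<and> (\<forall>u \<in> sphere 0 1. width_deriv K u \<le> ereal (p_fun K u))"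
proof (intro conjI ballI)
  show "(SUP (u, v) \<in> nonparallel_pairs. ereal (delta_width K u v)) \<le> ereal (M_hat K)"
    by (rule SUP_least) (auto intro: delta_width_le_M_hat[OF assms(2)])
  show "width_deriv K u \<le> ereal (p_fun K u)" if "u \<in> sphere 0 1" for u
    using width_deriv_le_p_fun[OF assms(2)] that by simp
qed

end
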